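(* Let $S_0$ be a zerosumfree commutative semiring and let $S = S_0[X,Y,Z]$ be the polynomial semiring in three variables over $S_0$, graded by total degree. Then $S$ is not a nucleus hemiring.
   Context: A (commutative) semiring is a set with operations $+,\cdot$ such that $(S_0,+)$ is a commutative monoid with identity $0$, $(S_0,\cdot)$ is a commutative monoid with identity $1\neq 0$, multiplication distributes over addition, and $0s=0$ for all $s$. It is zerosumfree if $a+b=0$ implies $a=b=0$. An ideal of a semiring $S$ is a nonempty subset $I$ with $a+b\in I$ and $sa\in I$ for all $a,b\in I$, $s\in S$. An ideal $I$ is subtractive if $x+y\in I$ and $x\in I$ imply $y\in I$, for all $x,y\in S$. $\operatorname{Id}(S)$ is the lattice of ideals of $S$ ordered by inclusion, with meet given by intersection. $\operatorname{scl}_S(I)$ is the intersection of all subtractive ideals of $S$ containing $I$. A nucleus map on a meet-semilattice $(P,\le)$ is a function $\nu:P\to P$ such that for all $x,y\in P$: $x\le\nu(x)$; $\nu(\nu(x))=\nu(x)$; $\nu(x\wedge y)=\nu(x)\wedge\nu(y)$. $S$ is a nucleus hemiring if $\operatorname{scl}_S$ is a nucleus map on $\operatorname{Id}(S)$. *)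

theory Defs
  imports "HOL-Library.Poly_Mapping" "HOL-Library.Numeral_Type"
begin

text \<open>A commutative semiring with \<open>0 \<noteq> 1\<close> is a type of the library class
  \<^class>\<open>comm_semiring_1\<close>; note that this class requires no additive cancellation.\<close>

definition zerosumfree :: "'a::comm_semiring_1 itself \<Rightarrow> bool" where
  "zerosumfree _ \<longleftrightarrow> (\<forall>a b :: 'a. a + b = 0 \<longrightarrow> a = 0 \<and> b = 0)"

definition semiring_ideal :: "'a::comm_semiring_1 set \<Rightarrow> bool" where
  "semiring_ideal I \<longleftrightarrow>
     I \<noteq> {} \<and> (\<forall>a\<in>I. \<forall>b\<in>I. a + b \<in> I) \<and> (\<forall>s. \<forall>a\<in>I. s * a \<in> I)"

definition subtractive_ideal :: "'a::comm_semiring_1 set \<Rightarrow> bool" where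
  "subtractive_ideal I \<longleftrightarrow>
     semiring_ideal I \<and> (\<forall>x y. x + y \<in> I \<longrightarrow> x \<in> I \<longrightarrow> y \<in> I)"

definition Ideals :: "'a::comm_semiring_1 itself \<Rightarrow> 'a set set" where
  "Ideals _ = {I. semiring_ideal I}"

definition scl :: "'a::comm_semiring_1 set \<Rightarrow> 'a set" where
  "scl I = \<Inter>{J. subtractive_ideal J \<and> I \<subseteq> J}"

text \<open>The meet-semilattice is a subset \<open>P\<close> of an ambient one, with the inherited order and meet.\<close>

definition nucleus_map_on :: "'p::semilattice_inf set \<Rightarrow> ('p \<Rightarrow> 'p) \<Rightarrow> bool" where
  "nucleus_map_on P \<nu> \<longleftrightarrow>
     (\<forall>x\<in>P. \<nu> x \<in> P) \<and>
     (\<forall>x\<in>P. x \<le> \<nu> x) \<and>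
     (\<forall>x\<in>P. \<nu> (\<nu> x) = \<nu> x) \<and>
     (\<forall>x\<in>P. \<forall>y\<in>P. \<nu> (inf x y) = inf (\<nu> x) (\<nu> y))"

definition nucleus_hemiring :: "'a::comm_semiring_1 itself \<Rightarrow> bool" where
  "nucleus_hemiring _ \<longleftrightarrow> nucleus_map_on (Ideals TYPE('a)) scl"

lemma semiring_ideal_zero: "semiring_ideal I \<Longrightarrow> 0 \<in> I"
  unfolding semiring_ideal_def by (metis all_not_in_conv mult_zero_left)

text \<open>Ideals are closed under the ambient meet and under \<^const>\<open>scl\<close>, so neither the meet nor the
  first clause of \<^const>\<open>nucleus_map_on\<close> can fail for a trivial reason.\<close>

lemma Ideals_inf: "I \<in> Ideals TYPE('a::comm_semiring_1) \<Longrightarrow> J \<in> Ideals TYPE('a) \<Longrightarrow> inf I J \<in> Ideals TYPE('a)"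
  using semiring_ideal_zero[of I] semiring_ideal_zero[of J]
  by (auto simp: Ideals_def semiring_ideal_def)

lemma Ideals_scl: "scl I \<in> Ideals TYPE('a::comm_semiring_1)"
proof -
  have scl_eq: "x \<in> scl I \<longleftrightarrow> (\<forall>J. subtractive_ideal J \<longrightarrow> I \<subseteq> J \<longrightarrow> x \<in> J)" for x :: 'a
    by (auto simp: scl_def)
  have ideal: "semiring_ideal J" if "subtractive_ideal J" for J :: "'a set"
    using that by (simp add: subtractive_ideal_def)
  have add: "a + b \<in> J" if "semiring_ideal J" "a \<in> J" "b \<in> J" for J and a b :: 'a
    using that by (simp add: semiring_ideal_def)
  have mult: "s * a \<in> J" if "semiring_ideal J" "a \<in> J" for J and s a :: 'a
    using that by (simp add: semiring_ideal_def)
  have "0 \<in> scl I"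
    by (simp add: scl_eq ideal semiring_ideal_zero)
  then have "scl I \<noteq> {}"
    by blast
  moreover have "\<forall>a\<in>scl I. \<forall>b\<in>scl I. a + b \<in> scl I"
    using add ideal by (simp add: scl_eq)
  moreover have "\<forall>s. \<forall>a\<in>scl I. s * a \<in> scl I"
    using mult ideal by (simp add: scl_eq)
  ultimately show ?thesis
    unfolding Ideals_def semiring_ideal_def by blast
qed

text \<open>Polynomials in three variables: finitely supported coefficient functions on the
  exponent vectors, the variables being indexed by the three-element type \<^typ>\<open>3\<close>.\<close>

type_synonym 'a mpoly3 = "(3 \<Rightarrow>\<^sub>0 nat) \<Rightarrow>\<^sub>0 'a"

definition total_degree :: "(3 \<Rightarrow>\<^sub>0 nat) \<Rightarrow> nat" where
  "total_degree m = (\<Sum>i\<in>UNIV. Poly_Mapping.lookup m i)"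

definition homogeneous :: "nat \<Rightarrow> 'a::comm_semiring_1 mpoly3 set" where
  "homogeneous d = {p. \<forall>m\<in>Poly_Mapping.keys p. total_degree m = d}"

definition is_grading :: "(nat \<Rightarrow> 'a::comm_semiring_1 set) \<Rightarrow> bool" where
  "is_grading A \<longleftrightarrow>
     (\<forall>d. 0 \<in> A d \<and> (\<forall>p\<in>A d. \<forall>q\<in>A d. p + q \<in> A d)) \<and>
     (\<forall>d e. \<forall>p\<in>A d. \<forall>q\<in>A e. p * q \<in> A (d + e)) \<and>
     (\<forall>p. \<exists>!f. finite {d. f d \<noteq> 0} \<and> (\<forall>d. f d \<in> A d) \<and> p = (\<Sum>d | f d \<noteq> 0. f d))"

lemma total_degree_add: "total_degree (m + n) = total_degree m + total_degree n"
  by (simp add: total_degree_def lookup_add sum.distrib)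

lemma lookup_homogeneous:
  "p \<in> homogeneous d \<Longrightarrow> total_degree m \<noteq> d \<Longrightarrow> Poly_Mapping.lookup p m = 0"
  unfolding homogeneous_def by (metis (mono_tags, lifting) in_keys_iff mem_Collect_eq)

lemma is_grading_homogeneous: "is_grading (homogeneous :: nat \<Rightarrow> 'a::comm_semiring_1 mpoly3 set)"
proof -
  have ex1: "\<exists>!f. finite {d. f d \<noteq> 0} \<and> (\<forall>d. f d \<in> homogeneous d) \<and> p = (\<Sum>d | f d \<noteq> 0. f d)"
    for p :: "'a mpoly3"
  proof -
    define g where
      "g d = (\<Sum>m\<in>{m\<in>Poly_Mapping.keys p. total_degree m = d}.
                Poly_Mapping.single m (Poly_Mapping.lookup p m))" for d
    have g: "Poly_Mapping.lookup (g d) m =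
        (if total_degree m = d then Poly_Mapping.lookup p m else 0)" for d m
      unfolding g_def
      by (auto simp: lookup_sum lookup_single when_def sum.If_cases in_keys_iff)
    have decomp: "Poly_Mapping.lookup (\<Sum>d | f d \<noteq> 0. f d) m = Poly_Mapping.lookup (f (total_degree m)) m"
      if fin: "finite {d. f d \<noteq> 0}" and hom: "\<forall>d. f d \<in> homogeneous d"
      for f :: "nat \<Rightarrow> 'a mpoly3" and m
    proof -
      have "Poly_Mapping.lookup (f d) m = (if d = total_degree m then Poly_Mapping.lookup (f (total_degree m)) m else 0)" for d
        using hom lookup_homogeneous[of "f d" d m] by auto
      then have "Poly_Mapping.lookup (\<Sum>d | f d \<noteq> 0. f d) m =
          (\<Sum>d | f d \<noteq> 0. if d = total_degree m then Poly_Mapping.lookup (f (total_degree m)) m else 0)"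
        unfolding lookup_sum by (intro sum.cong) auto
      also have "\<dots> = Poly_Mapping.lookup (f (total_degree m)) m"
        using fin by (auto simp: sum.delta)
      finally show ?thesis .
    qed
    have "{d. g d \<noteq> 0} \<subseteq> total_degree ` Poly_Mapping.keys p"
    proof
      fix d assume "d \<in> {d. g d \<noteq> 0}"
      then obtain m where "Poly_Mapping.lookup (g d) m \<noteq> 0"
        by (metis lookup_zero mem_Collect_eq poly_mapping_eqI)
      then show "d \<in> total_degree ` Poly_Mapping.keys p"
        by (auto simp: g in_keys_iff split: if_splits)
    qed
    then have fin: "finite {d. g d \<noteq> 0}"
      by (rule finite_subset) simp
    have hom: "\<forall>d. g d \<in> homogeneous d"
      by (auto simp: homogeneous_def in_keys_iff g split: if_splits)
    show ?thesis
    proof (rule ex1I[of _ g])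
      show "finite {d. g d \<noteq> 0} \<and> (\<forall>d. g d \<in> homogeneous d) \<and> p = (\<Sum>d | g d \<noteq> 0. g d)"
        using fin hom by (auto intro!: poly_mapping_eqI simp: decomp[OF fin hom] g)
    next
      fix f assume f: "finite {d. f d \<noteq> 0} \<and> (\<forall>d. f d \<in> homogeneous d) \<and> p = (\<Sum>d | f d \<noteq> 0. f d)"
      show "f = g"
      proof (intro ext poly_mapping_eqI)
        fix d m
        have "Poly_Mapping.lookup p m = Poly_Mapping.lookup (f (total_degree m)) m"
          using f decomp[of f m] by metis
        moreover have "Poly_Mapping.lookup (f d) m = 0" if "total_degree m \<noteq> d"
          using f that lookup_homogeneous by blast
        ultimately show "Poly_Mapping.lookup (f d) m = Poly_Mapping.lookup (g d) m"
          by (auto simp: g)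
      qed
    qed
  qed
  have mult: "p * q \<in> homogeneous (d + e)" if "p \<in> homogeneous d" "q \<in> homogeneous e"
    for p q :: "'a mpoly3" and d e
    using that keys_mult[of p q] by (fastforce simp: homogeneous_def total_degree_add)
  have add: "p + q \<in> homogeneous d" if "p \<in> homogeneous d" "q \<in> homogeneous d"
    for p q :: "'a mpoly3" and d
    using that Poly_Mapping.keys_add[of p q] by (auto simp: homogeneous_def)
  have zero: "(0 :: 'a mpoly3) \<in> homogeneous d" for d
    by (simp add: homogeneous_def)
  show ?thesis
    unfolding is_grading_def using zero add mult ex1 by blast
qed

end

theory Submission
  imports Defs
begin

text \<open>Reading off linear coefficients, \<open>Y\<close> lies in the subtractive closure of \<open>(X, X + Y)\<close> and of
  \<open>(Z, Z + Y)\<close>, while zerosumfreeness forces the intersection of these two ideals to have no linear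
  part. We replace the two ideals by larger ones that are cut out by conditions on the coefficients of
  degree at most one, so that no description of generated ideals is needed.\<close>

text \<open>In the convolution sum for the coefficient at \<open>k\<close>, the hypothesis kills
  every term with \<open>l \<noteq> 0\<close>, and \<open>l = 0\<close> forces
  \<open>q = k\<close>.\<close>

lemma lookup_mult_eq_lookup_zero_times:
  fixes f g :: "'m::monoid_add \<Rightarrow>\<^sub>0 'a::comm_semiring_1"
  assumes "\<And>l q. k = l + q \<Longrightarrow> l = 0 \<or> Poly_Mapping.lookup g q = 0"
  shows "Poly_Mapping.lookup (f * g) k = Poly_Mapping.lookup f 0 * Poly_Mapping.lookup g k"
proof -
  have "(\<Sum>q. Poly_Mapping.lookup g q when k = l + q) = (Poly_Mapping.lookup g k when l = 0)" for l
  proof (cases "l = 0")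
    case True
    then show ?thesis by simp
  next
    case False
    then have "(Poly_Mapping.lookup g q when k = l + q) = 0" for q
      using assms[of l q] by (auto simp: when_def)
    then show ?thesis using False by simp
  qed
  then have "Poly_Mapping.lookup (f * g) k = (\<Sum>l. Poly_Mapping.lookup f l * (Poly_Mapping.lookup g k when l = 0))"
    by (simp add: lookup_mult)
  also have "\<dots> = (\<Sum>l. Poly_Mapping.lookup f l * Poly_Mapping.lookup g k when l = 0)"
    by (simp add: mult_when)
  finally show ?thesis by simp
qed

abbreviation unit_exponent :: "3 \<Rightarrow> 3 \<Rightarrow>\<^sub>0 nat" where
  "unit_exponent i \<equiv> Poly_Mapping.single i 1"

abbreviation variable3 :: "3 \<Rightarrow> 'a::comm_semiring_1 mpoly3" where
  "variable3 i \<equiv> Poly_Mapping.single (unit_exponent i) 1"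

text \<open>Away from \<open>i\<close> both summands vanish, and at \<open>i\<close> two naturals
  with sum 1 include a zero.\<close>

lemma unit_exponent_eq_addD:
  assumes "unit_exponent i = l + q"
  shows "l = 0 \<or> q = 0"
proof -
  have sum: "Poly_Mapping.lookup l j + Poly_Mapping.lookup q j = (1 when i = j)" for j
    using arg_cong[OF assms, of "\<lambda>m. Poly_Mapping.lookup m j"] by (simp add: lookup_add lookup_single)
  have off: "Poly_Mapping.lookup l j = 0 \<and> Poly_Mapping.lookup q j = 0" if "j \<noteq> i" for j
    using that sum[of j] by simp
  have "Poly_Mapping.lookup l i = 0 \<or> Poly_Mapping.lookup q i = 0"
    using sum[of i] by (auto simp: when_def)
  then show ?thesis
    using off by (metis lookup_zero poly_mapping_eqI)
qed

lemma lookup_mult_zero: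
  "Poly_Mapping.lookup (p * q) 0 = Poly_Mapping.lookup p 0 * Poly_Mapping.lookup q 0" for p q :: "'a::comm_semiring_1 mpoly3"
proof (rule lookup_mult_eq_lookup_zero_times)
  fix l r :: "3 \<Rightarrow>\<^sub>0 nat" assume "0 = l + r"
  then have "Poly_Mapping.lookup l j + Poly_Mapping.lookup r j = 0" for j
    by (metis lookup_add lookup_zero)
  then show "l = 0 \<or> Poly_Mapping.lookup q r = 0"
    by (auto intro: poly_mapping_eqI)
qed

text \<open>The only other splitting of the exponent pairs the linear coefficient of
  \<open>p\<close> with the constant coefficient of \<open>q\<close>, which is zero.\<close>

lemma lookup_mult_unit_exponent:
  fixes p q :: "'a::comm_semiring_1 mpoly3"
  assumes "Poly_Mapping.lookup q 0 = 0"
  shows "Poly_Mapping.lookup (p * q) (unit_exponent i) = Poly_Mapping.lookup p 0 * Poly_Mapping.lookup q (unit_exponent i)"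
  using assms unit_exponent_eq_addD by (intro lookup_mult_eq_lookup_zero_times) metis

lemma lookup_variable3 [simp]:
  "Poly_Mapping.lookup (variable3 i) 0 = 0"
  "Poly_Mapping.lookup (variable3 i) (unit_exponent j) = (if i = j then 1 else 0)"
  by (auto simp: lookup_single when_def dest: arg_cong[of _ _ "\<lambda>m. Poly_Mapping.lookup m i"] split: if_splits)

text \<open>The linear part is \<open>c X\<^sub>i + d (X\<^sub>i + X\<^sub>j)\<close> when \<open>k\<close> is the remaining index.\<close>

definition linear_part_ideal :: "3 \<Rightarrow> 3 \<Rightarrow> 3 \<Rightarrow> 'a::comm_semiring_1 mpoly3 set" where
  "linear_part_ideal i j k = {p. Poly_Mapping.lookup p 0 = 0 \<and> Poly_Mapping.lookup p (unit_exponent k) = 0 \<and>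
     (\<exists>c. Poly_Mapping.lookup p (unit_exponent i) = c + Poly_Mapping.lookup p (unit_exponent j))}"

text \<open>Without constant terms, multiplication by \<open>s\<close> scales the linear
  coefficients by the constant coefficient of \<open>s\<close>. The witnesses \<open>c\<close> thus
  add under sums and scale under products.\<close>

lemma semiring_ideal_linear_part_ideal: "semiring_ideal (linear_part_ideal i j k)"
  unfolding semiring_ideal_def
proof (intro conjI ballI allI)
  have "0 \<in> linear_part_ideal i j k"
    by (simp add: linear_part_ideal_def)
  then show "linear_part_ideal i j k \<noteq> {}" by blast
next
  fix a b :: "'a mpoly3" assume a: "a \<in> linear_part_ideal i j k" and b: "b \<in> linear_part_ideal i j k"
  then obtain c d where "Poly_Mapping.lookup a (unit_exponent i) = c + Poly_Mapping.lookup a (unit_exponent j)"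
      "Poly_Mapping.lookup b (unit_exponent i) = d + Poly_Mapping.lookup b (unit_exponent j)"
    unfolding linear_part_ideal_def by blast
  then have "Poly_Mapping.lookup (a + b) (unit_exponent i) = (c + d) + Poly_Mapping.lookup (a + b) (unit_exponent j)"
    by (simp add: lookup_add ac_simps)
  then show "a + b \<in> linear_part_ideal i j k"
    using a b unfolding linear_part_ideal_def by (auto simp: lookup_add)
next
  fix s a :: "'a mpoly3" assume a: "a \<in> linear_part_ideal i j k"
  then have a0: "Poly_Mapping.lookup a 0 = 0"
    by (simp add: linear_part_ideal_def)
  obtain c where "Poly_Mapping.lookup a (unit_exponent i) = c + Poly_Mapping.lookup a (unit_exponent j)"
    using a unfolding linear_part_ideal_def by blast
  then have "Poly_Mapping.lookup (s * a) (unit_exponent i) = Poly_Mapping.lookup s 0 * c + Poly_Mapping.lookup (s * a) (unit_exponent j)"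
    by (simp only: lookup_mult_unit_exponent[OF a0] distrib_left)
  moreover have "Poly_Mapping.lookup (s * a) (unit_exponent k) = 0"
    using a lookup_mult_unit_exponent[OF a0, of s k] by (simp add: linear_part_ideal_def)
  ultimately show "s * a \<in> linear_part_ideal i j k"
    unfolding linear_part_ideal_def using a0 by (auto simp: lookup_mult_zero)
qed

lemma variable3_in_scl_linear_part_ideal:
  assumes "i \<noteq> j" "i \<noteq> k" "j \<noteq> k"
  shows "variable3 j \<in> scl (linear_part_ideal i j k)"
proof -
  have "variable3 i \<in> linear_part_ideal i j k" "variable3 i + variable3 j \<in> linear_part_ideal i j k"
    \<comment> \<open>The witness 0 serves the sum of the two variables, whose coefficients at
      \<open>i\<close> and \<open>j\<close> are both 1. Deleting \<open>One_nat_def\<close> keeps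
      the exponents in the form that \<open>lookup_variable3\<close> matches.\<close>
    using assms by (auto simp: linear_part_ideal_def lookup_add simp del: One_nat_def intro: exI[of _ 0])
  then show ?thesis
    unfolding scl_def subtractive_ideal_def by blast
qed

text \<open>Subtractivity holds because \<open>0 + b = b\<close> in each coefficient. The set serves
  as an upper bound for a closure that must miss the variable \<open>j\<close>.\<close>

lemma subtractive_ideal_no_linear_coeff:
  "subtractive_ideal {p :: 'a::comm_semiring_1 mpoly3. Poly_Mapping.lookup p 0 = 0 \<and> Poly_Mapping.lookup p (unit_exponent j) = 0}"
proof -
  have "\<exists>p :: 'a mpoly3. Poly_Mapping.lookup p 0 = 0 \<and> Poly_Mapping.lookup p (unit_exponent j) = 0"
    by (rule exI[of _ 0]) simp
  then show ?thesis
    unfolding subtractive_ideal_def semiring_ideal_def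
    by (auto simp: lookup_add lookup_mult_zero lookup_mult_unit_exponent simp del: One_nat_def)
qed

theorem theoremA6:
  assumes "zerosumfree TYPE('a::comm_semiring_1)"
  shows "\<not> nucleus_hemiring TYPE('a mpoly3)"
proof
  assume "nucleus_hemiring TYPE('a mpoly3)"
  \<comment> \<open>The indices 0, 1, 2 stand for \<open>X\<close>, \<open>Y\<close>,
    \<open>Z\<close>. Both ideals share the middle index, so \<open>Y\<close> lies in both
    closures.\<close>
  define I J :: "'a mpoly3 set" where "I = linear_part_ideal 0 1 2" and "J = linear_part_ideal 2 1 0"
  define K :: "'a mpoly3 set" where "K = {p. Poly_Mapping.lookup p 0 = 0 \<and> Poly_Mapping.lookup p (unit_exponent 1) = 0}"
  have "I \<in> Ideals TYPE('a mpoly3)" "J \<in> Ideals TYPE('a mpoly3)"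
    by (simp_all add: I_def J_def Ideals_def semiring_ideal_linear_part_ideal)
  with \<open>nucleus_hemiring TYPE('a mpoly3)\<close> have "scl (I \<inter> J) = scl I \<inter> scl J"
    by (auto simp: nucleus_hemiring_def nucleus_map_on_def)
  moreover have "variable3 1 \<in> scl I \<inter> scl J"
    by (simp add: I_def J_def variable3_in_scl_linear_part_ideal del: One_nat_def)
  moreover have "I \<inter> J \<subseteq> K"
  proof
    fix p assume "p \<in> I \<inter> J"
    \<comment> \<open>The coefficient of \<open>Z\<close> is zero by membership in \<open>I\<close>
      and exceeds that of \<open>Y\<close> by \<open>c\<close> by membership in \<open>J\<close>;
      zerosumfreeness then makes the coefficient of \<open>Y\<close> vanish.\<close>
    then obtain c where "Poly_Mapping.lookup p 0 = 0" "0 = c + Poly_Mapping.lookup p (unit_exponent 1)"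
      unfolding I_def J_def linear_part_ideal_def by auto
    then show "p \<in> K"
      using assms unfolding K_def zerosumfree_def by (metis (mono_tags, lifting) mem_Collect_eq)
  qed
  moreover have "subtractive_ideal K"
    unfolding K_def by (rule subtractive_ideal_no_linear_coeff)
  \<comment> \<open>\<open>K\<close> is one of the subtractive ideals whose intersection is
    \<open>scl (I \<inter> J)\<close>, and the nucleus law puts \<open>Y\<close> into that
    closure.\<close>
  ultimately have "variable3 1 \<in> K"
    unfolding scl_def by blast
  then show False
    by (simp add: K_def del: One_nat_def)
qed

end
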